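(* Let $F:\mathbb{R}^N\to\mathbb{R}^N$ be a locally Lipschitz mapping that defines a quasi-gradient vector field for $E$ on $\mathbb{R}^N$, for some differentiable function $E:\mathbb{R}^N\to\mathbb{R}$. Assume further that the function $E$ is KL. Let $u$ be any solution to $$u'(t)+F(u(t))=0,\quad t\in\mathbb{R}_+.$$ Then, (i) either $\|u(t)\|\to\infty$ as $t\to\infty$, (ii) or $u$ converges to a singular point $u_\infty$ of $F$ (i.e. $F(u_\infty)=0$) as $t\to\infty$. When (ii) holds then $u'\in L^1((0,\infty);\mathbb{R}^N)$ and $u'(t)\to0$ as $t\to\infty$. Moreover, we have the following estimate, $$\|u(t)-u_\infty\|\le\frac1\alpha\,\varphi\big(E(u(t))-E(u_\infty)\big),$$ where $\varphi$ is a desingularizing function of $E$ at $u_\infty$ and $\alpha$ is the constant in the angle condition.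
   Context: Quasi-gradient field: given a nonempty closed set $\Gamma\subset\mathbb{R}^N$ and a locally Lipschitz $F:\mathbb{R}^N\to\mathbb{R}^N$, $F$ is quasi-gradient on $\Gamma$ for a differentiable function $E:\mathbb{R}^N\to\mathbb{R}$ if there is $\alpha>0$ such that (angle condition) $\langle\nabla E(u),F(u)\rangle\ge\alpha\|\nabla E(u)\|\,\|F(u)\|$ for every $u\in\Gamma$, and (rest-points equivalence) $\operatorname{crit}E\cap\Gamma=F^{-1}(\{0\})\cap\Gamma$, where $\operatorname{crit}E=\{\nabla E=0\}$. Here $\Gamma=\mathbb{R}^N$. KL property and desingularizing function: a differentiable $E:\mathbb{R}^N\to\mathbb{R}$ has the KL property at $\bar u$ if there exist $r_0>0$, $\eta>0$ and $\varphi\in C([0,r_0);\mathbb{R}_+)$ such that (1) $\varphi(0)=0$, $\varphi$ is $C^1$ on $(0,r_0)$, concave, with $\varphi'>0$ on $(0,r_0)$; (2) $|E(u)-E(\bar u)|<r_0$ for all $u\in B(\bar u,\eta)$ (open ball), and $\|\nabla(\varphi\circ|E(\cdot)-E(\bar u)|)(u)\|\ge1$ for each $u\in B(\bar u,\eta)$ with $E(u)\ne E(\bar u)$. Such a $\varphi$ is called a desingularizing function of $E$ at $\bar u$. $E$ is a KL function if it has the KL property at every point of $\mathbb{R}^N$.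
   Formalization: The final estimate is stated for all t ≥ 0 with u(t) in the ball B(u_∞, η) on which φ is desingularizing (so for all large t); for unrestricted t it fails, e.g. N=1, E=x² near 0 then rising very slowly, φ=√, and u(0) far away. *)

theory Defs
  imports "HOL-Analysis.Analysis"
begin

definition locally_lipschitz :: "('a::metric_space \<Rightarrow> 'b::metric_space) \<Rightarrow> bool" where
  "locally_lipschitz F \<longleftrightarrow> (\<forall>x. \<exists>e>0. \<exists>L. L-lipschitz_on (ball x e) F)"

text \<open>Meaningful only at points where \<open>E\<close> is differentiable.\<close>

definition grad :: "('a::euclidean_space \<Rightarrow> real) \<Rightarrow> 'a \<Rightarrow> 'a" where
  "grad E x = (THE D. GDERIV E x :> D)"

definition crit :: "('a::euclidean_space \<Rightarrow> real) \<Rightarrow> 'a set" where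
  "crit E = {x. grad E x = 0}"

definition angle_constant ::
    "'a::euclidean_space set \<Rightarrow> ('a \<Rightarrow> 'a) \<Rightarrow> ('a \<Rightarrow> real) \<Rightarrow> real \<Rightarrow> bool" where
  "angle_constant \<Gamma> F E \<alpha> \<longleftrightarrow>
     0 < \<alpha> \<and> (\<forall>x\<in>\<Gamma>. inner (grad E x) (F x) \<ge> \<alpha> * norm (grad E x) * norm (F x))"

text \<open>Local Lipschitz continuity of \<open>F\<close> and differentiability of \<open>E\<close> are standing assumptions on
  the arguments and are not part of the predicate.\<close>

definition quasi_gradient_on ::
    "'a::euclidean_space set \<Rightarrow> ('a \<Rightarrow> 'a) \<Rightarrow> ('a \<Rightarrow> real) \<Rightarrow> bool" where
  "quasi_gradient_on \<Gamma> F E \<longleftrightarrow>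
     \<Gamma> \<noteq> {} \<and> closed \<Gamma> \<and>
     (\<exists>\<alpha>. angle_constant \<Gamma> F E \<alpha>) \<and>
     crit E \<inter> \<Gamma> = F -` {0} \<inter> \<Gamma>"

text \<open>\<open>\<phi>\<close> desingularizes \<open>E\<close> at \<open>a\<close>, with range parameter \<open>r\<close> and radius \<open>\<eta>\<close>. Only the values of
  \<open>\<phi>\<close> on \<open>{0..<r}\<close> matter: \<open>\<bar>E x - E a\<bar>\<close> stays in that interval on the open ball, so the gradient
  in the last clause does not see how \<open>\<phi>\<close> is extended.\<close>

definition desingularizing ::
    "('a::euclidean_space \<Rightarrow> real) \<Rightarrow> 'a \<Rightarrow> real \<Rightarrow> real \<Rightarrow> (real \<Rightarrow> real) \<Rightarrow> bool" where
  "desingularizing E a r \<eta> \<phi> \<longleftrightarrow>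
     0 < r \<and> 0 < \<eta> \<and>
     continuous_on {0..<r} \<phi> \<and> (\<forall>s\<in>{0..<r}. 0 \<le> \<phi> s) \<and>
     \<phi> 0 = 0 \<and> \<phi> C1_differentiable_on {0<..<r} \<and> concave_on {0..<r} \<phi> \<and>
     (\<forall>s\<in>{0<..<r}. 0 < deriv \<phi> s) \<and>
     (\<forall>x\<in>ball a \<eta>. \<bar>E x - E a\<bar> < r) \<and>
     (\<forall>x\<in>ball a \<eta>. E x \<noteq> E a \<longrightarrow> 1 \<le> norm (grad (\<lambda>y. \<phi> \<bar>E y - E a\<bar>) x))"

definition KL_at :: "('a::euclidean_space \<Rightarrow> real) \<Rightarrow> 'a \<Rightarrow> bool" where
  "KL_at E a \<longleftrightarrow> (\<exists>r \<eta> \<phi>. desingularizing E a r \<eta> \<phi>)"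

definition KL_function :: "('a::euclidean_space \<Rightarrow> real) \<Rightarrow> bool" where
  "KL_function E \<longleftrightarrow> (\<forall>a. KL_at E a)"

end

theory Submission
  imports Defs
begin

text \<open>The energy decreases along a trajectory. While the trajectory stays in the ball where \<open>\<phi>\<close> desingularizes
  \<open>E\<close> at a point \<open>a\<close> with \<open>E a \<le> E (u t)\<close>, the angle condition and the KL inequality give
  \<open>- (\<phi> (E u - E a))' \<ge> \<alpha> \<parallel>u'\<parallel>\<close>, so the remaining length is at most \<open>\<phi> (E u - E a) / \<alpha>\<close>. If
  \<open>\<parallel>u\<parallel>\<close> does not tend to infinity, \<open>u\<close> has a limit point \<open>a\<close>; once \<open>u\<close> is close enough to \<open>a\<close>, its
  remaining length is too small for it to leave the ball, so \<open>u\<close> has finite length and converges to \<open>a\<close>.\<close>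

subsection \<open>Real-variable preliminaries\<close>

lemma locally_lipschitz_imp_continuous_on:
  assumes "locally_lipschitz F"
  shows "continuous_on UNIV F"
proof -
  have "isCont F x" for x
  proof -
    obtain e L where "e > 0" "L-lipschitz_on (ball x e) F"
      using assms unfolding locally_lipschitz_def by blast
    then show ?thesis
      by (metis centre_in_ball continuous_on_interior interior_ball lipschitz_on_continuous_on)
  qed
  then show ?thesis
    by (simp add: continuous_at_imp_continuous_on)
qed

text \<open>The times in \<open>{s..t}\<close> with \<open>c \<le> f\<close> form a nonempty compact
  set, whose least element is the required moment. It serves as first exit time from a ball and as
  first time the energy reaches a level.\<close>

lemma first_time_ge:
  fixes f :: "real \<Rightarrow> real"
  assumes "continuous_on {s..t} f" "s \<le> t" "c \<le> f t"
  obtains \<tau> where "s \<le> \<tau>" "\<tau> \<le> t" "c \<le> f \<tau>" "\<And>x. s \<le> x \<Longrightarrow> x < \<tau> \<Longrightarrow> f x < c"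
proof -
  let ?S = "{x \<in> {s..t}. c \<le> f x}"
  have "closed ?S"
    using assms(1) by (intro continuous_on_closed_Collect_le continuous_intros) auto
  then have "compact ?S"
    by (auto simp: compact_eq_bounded_closed intro: bounded_subset[OF bounded_closed_interval[of s t]])
  moreover have "t \<in> ?S"
    using assms by auto
  ultimately obtain \<tau> where "\<tau> \<in> ?S" "\<forall>x\<in>?S. \<tau> \<le> x"
    using compact_attains_inf by blast
  then show thesis
    using that by force
qed

text \<open>Time reversal turns this into the existence of a first time.\<close>

lemma last_time_ge:
  fixes f :: "real \<Rightarrow> real"
  assumes "continuous_on {s..t} f" "s \<le> t" "c \<le> f s"
  obtains \<tau> where "s \<le> \<tau>" "\<tau> \<le> t" "c \<le> f \<tau>" "\<And>x. \<tau> < x \<Longrightarrow> x \<le> t \<Longrightarrow> f x < c"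
proof -
  have "continuous_on {-t..-s} (\<lambda>x. f (- x))"
    by (rule continuous_on_compose2[OF assms(1)]) (auto intro!: continuous_intros)
  then obtain \<tau> where "-t \<le> \<tau>" "\<tau> \<le> -s" "c \<le> f (-\<tau>)"
      and "\<And>x. -t \<le> x \<Longrightarrow> x < \<tau> \<Longrightarrow> f (-x) < c"
    using assms by (elim first_time_ge) auto
  then show thesis
    using that[of "-\<tau>"] by (metis minus_le_iff minus_less_iff neg_le_iff_le add.inverse_inverse)
qed

subsection \<open>Gradients and desingularizing functions\<close>

text \<open>Uniqueness of the derivative and nondegeneracy of the inner product make the description
  in \<open>grad\<close> well defined.\<close>

lemma gderiv_grad:
  fixes E :: "'a::euclidean_space \<Rightarrow> real"
  assumes "GDERIV E x :> D"
  shows "grad E x = D"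
  unfolding grad_def
proof (rule the_equality)
  fix D' assume "GDERIV E x :> D'"
  then have "(\<lambda>h. inner h D') = (\<lambda>h. inner h D)"
    using assms unfolding gderiv_def by (rule has_derivative_unique)
  then have "inner h D' = inner h D" for h
    by meson
  then show "D' = D"
    by (metis vector_eq_ldot)
qed fact

text \<open>Riesz representation: a linear functional is the inner product with its adjoint applied
  to 1.\<close>

lemma differentiable_imp_gderiv_grad:
  fixes E :: "'a::euclidean_space \<Rightarrow> real"
  assumes "E differentiable (at x)"
  shows "GDERIV E x :> grad E x"
proof -
  obtain E' where E': "(E has_derivative E') (at x)"
    using assms unfolding differentiable_def by blast
  then have "linear E'"
    by (rule has_derivative_linear)
  then have "E' = (\<lambda>h. inner h (adjoint E' 1))"
    using adjoint_works[of E' _ 1] by (simp add: inner_commute fun_eq_iff)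
  then have "GDERIV E x :> adjoint E' 1"
    using E' unfolding gderiv_def by metis
  then show ?thesis
    by (simp add: gderiv_grad)
qed

lemma desingularizing_range:
  assumes "desingularizing E a r \<eta> \<phi>" "x \<in> ball a \<eta>"
  shows "\<bar>E x - E a\<bar> < r"
  using assms unfolding desingularizing_def by blast

lemma desingularizing_DERIV:
  assumes "desingularizing E a r \<eta> \<phi>" "s \<in> {0<..<r}"
  shows "(\<phi> has_real_derivative deriv \<phi> s) (at s)"
proof -
  have "\<phi> differentiable at s"
    using assms unfolding desingularizing_def C1_differentiable_on_eq by blast
  then show ?thesis
    using DERIV_deriv_iff_real_differentiable by blast
qed

text \<open>The derivative is positive inside the interval, and continuity extends the comparison to
  \<open>s = 0\<close>.\<close>

lemma desingularizing_mono:
  assumes "desingularizing E a r \<eta> \<phi>" "0 \<le> s" "s \<le> t" "t < r"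
  shows "\<phi> s \<le> \<phi> t"
proof (cases "s = t")
  case False
  have "continuous_on {s..t} \<phi>"
    using assms unfolding desingularizing_def by (meson atLeastAtMost_subseteq_atLeastLessThan_iff continuous_on_subset)
  moreover have "\<exists>y. DERIV \<phi> x :> y \<and> 0 < y" if "s < x" "x < t" for x
    using assms that desingularizing_DERIV[OF assms(1), of x] unfolding desingularizing_def by force
  ultimately show ?thesis
    using DERIV_pos_imp_increasing_open[of s t \<phi>] False assms by force
qed simp

text \<open>Above the level \<open>E a\<close> the absolute value opens with a plus sign near
  \<open>E x\<close>, so the chain rule applies; positivity of the derivative of
  \<open>\<phi>\<close> then lets it leave the norm.\<close>

lemma desingularizing_gradient_bound:
  assumes "desingularizing E a r \<eta> \<phi>" "E differentiable (at x)" "x \<in> ball a \<eta>" "E a < E x"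
  shows "1 \<le> deriv \<phi> (E x - E a) * norm (grad E x)"
proof -
  let ?d = "E x - E a"
  have d: "?d \<in> {0<..<r}"
    using desingularizing_range[OF assms(1,3)] assms(4) by simp
  have "(\<phi> has_real_derivative deriv \<phi> ?d) (at \<bar>?d\<bar>)"
    using desingularizing_DERIV[OF assms(1) d] d by simp
  moreover have "((\<lambda>y. \<bar>y - E a\<bar>) has_real_derivative 1) (at (E x))"
  proof (rule has_field_derivative_transform_within_open)
    show "((\<lambda>y. y - E a) has_real_derivative 1) (at (E x))"
      by (auto intro!: derivative_eq_intros)
    show "open {E a<..}"
      by simp
  qed (use d in auto)
  ultimately have "((\<lambda>y. \<phi> \<bar>y - E a\<bar>) has_real_derivative deriv \<phi> ?d) (at (E x))"
    using DERIV_chain2[of \<phi> _ "\<lambda>y. \<bar>y - E a\<bar>" "E x"] by fastforce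
  then have "GDERIV (\<lambda>y. \<phi> \<bar>E y - E a\<bar>) x :> deriv \<phi> ?d *\<^sub>R grad E x"
    using GDERIV_DERIV_compose[OF differentiable_imp_gderiv_grad[OF assms(2)]] by blast
  then have "grad (\<lambda>y. \<phi> \<bar>E y - E a\<bar>) x = deriv \<phi> ?d *\<^sub>R grad E x"
    by (rule gderiv_grad)
  moreover have "1 \<le> norm (grad (\<lambda>y. \<phi> \<bar>E y - E a\<bar>) x)" "0 < deriv \<phi> ?d"
    using assms d unfolding desingularizing_def by auto
  ultimately show ?thesis
    by simp
qed

subsection \<open>Integrability and convergence on a half-line\<close>

text \<open>The partial integrals of the norm are increasing and bounded, hence converge to their
  supremum; continuity supplies measurability.\<close>

lemma absolutely_integrable_on_atLeastI:
  fixes f :: "real \<Rightarrow> 'a::euclidean_space"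
  assumes cont: "continuous_on {a..} f"
    and bound: "\<And>t. a \<le> t \<Longrightarrow> integral {a..t} (\<lambda>x. norm (f x)) \<le> B"
  shows "f absolutely_integrable_on {a..}"
proof -
  let ?I = "\<lambda>t. integral {a..t} (\<lambda>x. norm (f x))"
  have int: "(\<lambda>x. norm (f x)) integrable_on {a..t}" for t
    by (intro integrable_continuous_real continuous_intros continuous_on_subset[OF cont]) auto
  have mono: "?I s \<le> ?I t" if "s \<le> t" for s t
    using that int by (intro integral_subset_le) auto
  \<comment> \<open>The given bound concerns \<open>a \<le> t\<close>; monotonicity extends it to
    all real \<open>t\<close>, over which the supremum ranges.\<close>
  have ub: "?I t \<le> B" for t
    by (metis bound linorder_linear mono order_trans)
  then have bdd: "bdd_above (range ?I)"
    by (auto intro!: bdd_aboveI)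
  have "(?I \<longlongrightarrow> (SUP t. ?I t)) at_top"
  proof (rule increasing_tendsto)
    show "\<forall>\<^sub>F t in at_top. ?I t \<le> (SUP t. ?I t)"
      by (intro always_eventually allI cSUP_upper bdd) auto
    fix x assume "x < (SUP t. ?I t)"
    then obtain s where "x < ?I s"
      using less_cSUP_iff[OF _ bdd] by auto
    then show "\<forall>\<^sub>F t in at_top. x < ?I t"
      using mono by (intro eventually_mono[OF eventually_ge_at_top[of s]]) force
  qed
  then have "(\<lambda>x. norm (f x)) integrable_on {a..}"
    using has_integral_to_inf[OF int] by (metis has_integral_integrable norm_ge_zero)
  then show ?thesis
    using cont by (intro measurable_bounded_by_integrable_imp_absolutely_integrable
        continuous_imp_measurable_on_sets_lebesgue) auto
qed

text \<open>With a nonzero velocity limit \<open>v\<close>, late displacements over unit time would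
  stay close to \<open>v\<close>, while convergence of \<open>u\<close> makes them vanish.\<close>

lemma convergent_imp_limit_velocity_eq_0:
  fixes u :: "real \<Rightarrow> 'a::real_normed_vector"
  assumes deriv: "\<And>t. t > 0 \<Longrightarrow> (u has_vector_derivative u' t) (at t)"
    and lim: "(u \<longlongrightarrow> a) at_top" and lim': "(u' \<longlongrightarrow> v) at_top"
  shows "v = 0"
proof (rule ccontr)
  assume "v \<noteq> 0"
  \<comment> \<open>Over one unit of time the velocity error contributes at most half of
    \<open>norm v\<close>, and two distances below a quarter keep the displacement below the other
    half.\<close>
  then have "\<forall>\<^sub>F t in at_top. norm (u' t - v) < norm v / 2 \<and> norm (u t - a) < norm v / 4 \<and> t > 0"
    using tendstoD[OF lim', of "norm v / 2"] tendstoD[OF lim, of "norm v / 4"]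
    by (auto simp: dist_norm eventually_conj_iff eventually_gt_at_top)
  then obtain T where T: "\<And>t. t \<ge> T \<Longrightarrow> norm (u' t - v) < norm v / 2"
    "\<And>t. t \<ge> T \<Longrightarrow> norm (u t - a) < norm v / 4" "\<And>t. t \<ge> T \<Longrightarrow> t > 0"
    unfolding eventually_at_top_linorder by blast
  have d: "((\<lambda>t. u t - t *\<^sub>R v) has_vector_derivative (u' t - v)) (at t)" if "t \<ge> T" for t
    using deriv[OF T(3)[OF that]] by (auto intro!: derivative_eq_intros)
  have "norm ((u (T+1) - (T+1) *\<^sub>R v) - (u T - T *\<^sub>R v)) \<le> norm v / 2 * (T+1) - norm v / 2 * T"
  proof (rule differentiable_bound_general[where f' = "\<lambda>t. u' t - v" and \<phi>' = "\<lambda>t. norm v / 2"])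
    show "continuous_on {T..T+1} (\<lambda>t. u t - t *\<^sub>R v)"
      using d by (intro continuous_at_imp_continuous_on ballI)
        (metis atLeastAtMost_iff has_vector_derivative_continuous)
    show "norm (u' x - v) \<le> norm v / 2" if "T < x" for x
      using T(1)[of x] that by simp
  qed (use d in \<open>auto intro!: continuous_intros derivative_eq_intros\<close>)
  then have "norm ((u (T+1) - u T) - v) \<le> norm v / 2"
    by (simp add: algebra_simps)
  moreover have "norm (u (T+1) - u T) < norm v / 2"
    using norm_triangle_ineq4[of "u (T+1) - a" "u T - a"] T(2)[of T] T(2)[of "T+1"] by simp
  ultimately show False
    using norm_triangle_ineq2[of v "u (T+1) - u T"] by (simp add: norm_minus_commute)
qed

subsection \<open>Trajectories of a quasi-gradient field\<close>

text \<open>\<open>\<alpha>\<close> is a parameter so that the estimate can be read off for every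
  angle constant.\<close>

locale angle_descent_flow =
  fixes F :: "'a::euclidean_space \<Rightarrow> 'a" and E :: "'a \<Rightarrow> real" and u :: "real \<Rightarrow> 'a" and \<alpha> :: real
  assumes continuous_field: "continuous_on UNIV F"
    and differentiable_energy: "E differentiable (at x)"
    and angle: "angle_constant UNIV F E \<alpha>"
    and rest_points: "grad E x = 0 \<Longrightarrow> F x = 0"
    and solution: "t \<ge> 0 \<Longrightarrow> (u has_vector_derivative - F (u t)) (at t within {0..})"
begin

lemma alpha_pos: "\<alpha> > 0"
  using angle by (simp add: angle_constant_def)

lemma angle_ineq: "\<alpha> * norm (grad E x) * norm (F x) \<le> inner (grad E x) (F x)"
  using angle by (simp add: angle_constant_def)

lemma continuous_solution: "continuous_on {0..} u"
  using solution by (meson atLeast_iff continuous_on_eq_continuous_within has_vector_derivative_continuous)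

lemma continuous_energy: "continuous_on UNIV E"
  by (simp add: continuous_at_imp_continuous_on differentiable_energy differentiable_imp_continuous_within)

lemma continuous_energy_solution: "continuous_on {0..} (\<lambda>t. E (u t))"
  by (rule continuous_on_compose2[OF continuous_energy continuous_solution]) auto

lemma continuous_field_solution: "continuous_on {0..} (\<lambda>t. F (u t))"
  by (rule continuous_on_compose2[OF continuous_field continuous_solution]) auto

lemma solution_at:
  assumes "t > 0"
  shows "(u has_vector_derivative - F (u t)) (at t)"
proof -
  have "(u has_vector_derivative - F (u t)) (at t within {0<..})"
    using solution[of t] assms by (auto intro: has_vector_derivative_within_subset)
  then show ?thesis
    using assms by (simp add: has_vector_derivative_within_open[of t "{0<..}"])
qed

lemma energy_deriv:
  assumes "t > 0"
  shows "((\<lambda>t. E (u t)) has_real_derivative - inner (grad E (u t)) (F (u t))) (at t)"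
proof -
  have "(E has_derivative (\<lambda>h. inner h (grad E (u t)))) (at (u t))"
    using differentiable_imp_gderiv_grad[OF differentiable_energy] by (simp add: gderiv_def)
  from vector_derivative_diff_chain_within[OF solution_at[OF assms] has_derivative_at_withinI[OF this]]
  show ?thesis
    by (simp add: o_def has_real_derivative_iff_has_vector_derivative inner_commute)
qed

section \<open>Energy dissipation and rest\<close>

lemma dissipation_nonneg: "0 \<le> inner (grad E x) (F x)"
  using angle_ineq[of x] alpha_pos
  by (meson dual_order.trans less_imp_le mult_nonneg_nonneg norm_ge_zero)

lemma energy_antimono:
  assumes "0 \<le> s" "s \<le> t"
  shows "E (u t) \<le> E (u s)"
proof (rule DERIV_nonpos_imp_decreasing_open[OF assms(2)])
  show "\<exists>y. DERIV (\<lambda>t. E (u t)) x :> y \<and> y \<le> 0" if "s < x" for x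
    using energy_deriv[of x] dissipation_nonneg[of "u x"] that assms by force
  show "continuous_on {s..t} (\<lambda>t. E (u t))"
    using assms by (intro continuous_on_subset[OF continuous_energy_solution]) auto
qed

text \<open>Monotone energy with no net loss is constant, so the dissipation vanishes; the angle
  condition then forces \<open>grad E\<close> or \<open>F\<close> to vanish, and critical points are
  rest points.\<close>

lemma energy_constant_imp_rest:
  assumes "0 \<le> s" "E (u s) \<le> E (u t)" "s < x" "x < t"
  shows "F (u x) = 0"
proof -
  have "E (u y) = E (u s)" if "y \<in> {s<..<t}" for y
    using energy_antimono[of s y] energy_antimono[of y t] that assms by force
  then have "((\<lambda>t. E (u t)) has_real_derivative 0) (at x)"
    using assms
    by (intro has_field_derivative_transform_within_open[OF DERIV_const open_greaterThanLessThan[of s t]]) auto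
  then have "inner (grad E (u x)) (F (u x)) = 0"
    using DERIV_unique[OF energy_deriv[of x]] assms by force
  then have "grad E (u x) = 0 \<or> F (u x) = 0"
    using angle_ineq[of "u x"] alpha_pos by (auto simp: mult_le_0_iff)
  then show ?thesis
    using rest_points by blast
qed

text \<open>The general \<open>g\<close> covers both \<open>u\<close> itself and its arc length. When the energy reaches \<open>E a\<close> before time
  \<open>t\<close>, \<open>\<phi>\<close> need not be differentiable there; from that moment on the trajectory is at rest.\<close>

lemma desingularized_length_bound:
  fixes g :: "real \<Rightarrow> 'b::real_normed_vector"
  assumes \<phi>: "desingularizing E a r \<eta> \<phi>" and "0 \<le> s" "s \<le> t"
    and start: "u s \<in> ball a \<eta>"
    and ball: "\<And>x. s \<le> x \<Longrightarrow> x < t \<Longrightarrow> u x \<in> ball a \<eta>"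
    and above: "E a \<le> E (u t)"
    and cont: "continuous_on {s..t} g"
    and deriv: "\<And>x. s < x \<Longrightarrow> x < t \<Longrightarrow> (g has_vector_derivative g' x) (at x)"
    and speed: "\<And>x. s < x \<Longrightarrow> x < t \<Longrightarrow> norm (g' x) \<le> norm (F (u x))"
  shows "norm (g t - g s) \<le> \<phi> (E (u s) - E a) / \<alpha>"
proof -
  have contE: "continuous_on {s..t} (\<lambda>x. E (u x))"
    using \<open>0 \<le> s\<close> by (intro continuous_on_subset[OF continuous_energy_solution]) auto
  \<comment> \<open>For \<open>s = t\<close> the hypothesis \<open>ball\<close> is vacuous, hence
    the separate hypothesis \<open>start\<close>.\<close>
  have "\<bar>E (u s) - E a\<bar> < r"
    using \<phi> start by (rule desingularizing_range)
  then have range: "E (u x) - E a \<in> {0..<r}" if "x \<in> {s..t}" for x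
    using energy_antimono[of s x] energy_antimono[of x t] that above \<open>0 \<le> s\<close> by auto
  \<comment> \<open>Strictness is asked before \<open>\<tau>\<close> only, so \<open>\<tau>\<close>
    may be the first moment at which the level \<open>E a\<close> is reached.\<close>
  have *: "norm (g \<tau> - g s) \<le> \<phi> (E (u s) - E a) / \<alpha>"
    if \<tau>: "s \<le> \<tau>" "\<tau> \<le> t" and pos: "\<And>x. s \<le> x \<Longrightarrow> x < \<tau> \<Longrightarrow> E a < E (u x)" for \<tau>
  proof (cases "s = \<tau>")
    case True
    then show ?thesis
      using range[of s] \<phi> \<tau> alpha_pos by (simp add: desingularizing_def)
  next
    case False
    \<comment> \<open>The growth rate \<open>?D\<close> of \<open>?H\<close> dominates the speed, so
      the mean value inequality bounds the displacement of \<open>g\<close> by the increase of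
      \<open>?H\<close>.\<close>
    let ?H = "\<lambda>x. - \<phi> (E (u x) - E a) / \<alpha>"
    let ?D = "\<lambda>x. deriv \<phi> (E (u x) - E a) * inner (grad E (u x)) (F (u x)) / \<alpha>"
    have "norm (g \<tau> - g s) \<le> ?H \<tau> - ?H s"
    proof (rule differentiable_bound_general)
      show "s < \<tau>"
        using False \<tau> by simp
      show "continuous_on {s..\<tau>} g"
        using cont by (rule continuous_on_subset) (use \<tau> in auto)
      have "continuous_on {s..\<tau>} (\<lambda>x. \<phi> (E (u x) - E a))"
      proof (rule continuous_on_compose2[of "{0..<r}" \<phi>])
        show "continuous_on {0..<r} \<phi>"
          using \<phi> by (simp add: desingularizing_def)
        show "continuous_on {s..\<tau>} (\<lambda>x. E (u x) - E a)"
          using \<tau> by (intro continuous_intros continuous_on_subset[OF contE]) auto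
      qed (use range \<tau> in auto)
      then show "continuous_on {s..\<tau>} ?H"
        using alpha_pos by (intro continuous_intros) auto
      fix x assume x: "s < x" "x < \<tau>"
      show "(g has_vector_derivative g' x) (at x)"
        using deriv x \<tau> by simp
      have d: "E (u x) - E a \<in> {0<..<r}"
        using range[of x] pos[of x] x \<tau> by auto
      have "((\<lambda>x. E (u x) - E a) has_real_derivative - inner (grad E (u x)) (F (u x))) (at x)"
        using x \<open>0 \<le> s\<close> by (auto intro!: derivative_eq_intros energy_deriv)
      then have "((\<lambda>x. \<phi> (E (u x) - E a)) has_real_derivative
               deriv \<phi> (E (u x) - E a) * - inner (grad E (u x)) (F (u x))) (at x)"
        by (rule DERIV_chain2[where g = "\<lambda>x. E (u x) - E a", OF desingularizing_DERIV[OF \<phi> d]])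
      from DERIV_cdivide[OF DERIV_minus[OF this], of \<alpha>]
      show "(?H has_vector_derivative ?D x) (at x)"
        by (simp add: has_real_derivative_iff_has_vector_derivative)
      have "1 \<le> deriv \<phi> (E (u x) - E a) * norm (grad E (u x))"
        using x \<tau> by (intro desingularizing_gradient_bound[OF \<phi> differentiable_energy] ball pos) auto
      then have "norm (F (u x)) \<le> deriv \<phi> (E (u x) - E a) * norm (grad E (u x)) * norm (F (u x))"
        by (simp add: mult_le_cancel_right1)
      also have "\<dots> = deriv \<phi> (E (u x) - E a) * (\<alpha> * norm (grad E (u x)) * norm (F (u x))) / \<alpha>"
        using alpha_pos by simp
      also have "\<dots> \<le> ?D x"
      proof -
        have "0 < deriv \<phi> (E (u x) - E a)"
          using \<phi> d by (simp add: desingularizing_def)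
        then show ?thesis
          using angle_ineq[of "u x"] alpha_pos by (intro divide_right_mono mult_left_mono) auto
      qed
      finally show "norm (g' x) \<le> ?D x"
        using speed[of x] x \<tau> by linarith
    qed
    moreover have "0 \<le> \<phi> (E (u \<tau>) - E a) / \<alpha>"
      using range[of \<tau>] \<phi> \<tau> alpha_pos by (simp add: desingularizing_def)
    ultimately show ?thesis
      by simp
  qed
  show ?thesis
  proof (cases "E a < E (u t)")
    case True
    then have "E a < E (u x)" if "s \<le> x" "x < t" for x
      using energy_antimono[of x t] that \<open>0 \<le> s\<close> by simp
    then show ?thesis
      using *[of t] \<open>s \<le> t\<close> by blast
  next
    case False
    then have "- E a \<le> - E (u t)"
      by simp
    then obtain \<tau> where \<tau>: "s \<le> \<tau>" "\<tau> \<le> t" "- E a \<le> - E (u \<tau>)"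
        "\<And>x. s \<le> x \<Longrightarrow> x < \<tau> \<Longrightarrow> - E (u x) < - E a"
      using first_time_ge[OF continuous_on_minus[OF contE] \<open>s \<le> t\<close>] by blast
    have "E (u \<tau>) \<le> E (u t)"
      using \<tau> above by simp
    have "g t = g \<tau>"
    proof (cases "\<tau> = t")
      case False
      have "norm (g t - g \<tau>) \<le> (\<lambda>x. 0::real) t - (\<lambda>x. 0) \<tau>"
      proof (rule differentiable_bound_general[where f' = g' and \<phi>' = "\<lambda>x. 0"])
        show "continuous_on {\<tau>..t} g"
          using cont by (rule continuous_on_subset) (use \<tau> in auto)
        show "norm (g' x) \<le> 0" if "\<tau> < x" "x < t" for x
          using speed[of x] energy_constant_imp_rest[of \<tau> t x] that \<tau> \<open>E (u \<tau>) \<le> E (u t)\<close> \<open>0 \<le> s\<close>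
          by simp
      qed (use \<tau> False deriv in auto)
      then show ?thesis
        by simp
    qed simp
    then show ?thesis
      using *[of \<tau>] \<tau> by simp
  qed
qed

section \<open>Trapping near a limit point\<close>

lemma desingularized_displacement_bound:
  assumes "desingularizing E a r \<eta> \<phi>" "0 \<le> s" "s \<le> t" "u s \<in> ball a \<eta>"
    and "\<And>x. s \<le> x \<Longrightarrow> x < t \<Longrightarrow> u x \<in> ball a \<eta>" and "E a \<le> E (u t)"
  shows "norm (u t - u s) \<le> \<phi> (E (u s) - E a) / \<alpha>"
proof (rule desingularized_length_bound[OF assms])
  show "continuous_on {s..t} u"
    using \<open>0 \<le> s\<close> by (intro continuous_on_subset[OF continuous_solution]) auto
  show "(u has_vector_derivative - F (u x)) (at x)" if "s < x" for x
    using that \<open>0 \<le> s\<close> by (intro solution_at) simp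
qed auto

text \<open>Eventually \<open>T n\<close> exceeds \<open>t\<close>, so monotonicity of the energy
  passes to the limit along the sequence.\<close>

lemma energy_ge_limit_point:
  assumes "filterlim T at_top sequentially" "(\<lambda>n. u (T n)) \<longlonglongrightarrow> a" "0 \<le> t"
  shows "E a \<le> E (u t)"
proof -
  have "(\<lambda>n. E (u (T n))) \<longlonglongrightarrow> E a"
    using continuous_energy assms(2) by (auto intro: continuous_on_tendsto_compose)
  moreover have "\<forall>\<^sub>F n in sequentially. t \<le> T n"
    using assms(1) by (simp add: filterlim_at_top)
  then have "\<forall>\<^sub>F n in sequentially. E (u (T n)) \<le> E (u t)"
    by (rule eventually_mono) (use energy_antimono[OF assms(3)] in auto)
  ultimately show ?thesis
    by (rule tendsto_upperbound) simp
qed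

text \<open>At a first exit time, the initial distance plus the displacement since \<open>s\<close>
  would still be below \<open>\<eta>\<close>.\<close>

lemma trapping:
  assumes \<phi>: "desingularizing E a r \<eta> \<phi>" and above: "\<And>t. 0 \<le> t \<Longrightarrow> E a \<le> E (u t)" and "0 \<le> s"
    and small: "norm (u s - a) + \<phi> (E (u s) - E a) / \<alpha> < \<eta>" and "u s \<in> ball a \<eta>"
    and "s \<le> t"
  shows "u t \<in> ball a \<eta>"
proof (rule ccontr)
  assume "u t \<notin> ball a \<eta>"
  then have "\<eta> \<le> norm (u t - a)"
    by (simp add: dist_norm norm_minus_commute)
  moreover have "continuous_on {s..t} (\<lambda>x. norm (u x - a))"
    using \<open>0 \<le> s\<close> by (intro continuous_intros continuous_on_subset[OF continuous_solution]) auto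
  ultimately obtain \<tau> where \<tau>: "s \<le> \<tau>" "\<tau> \<le> t" "\<eta> \<le> norm (u \<tau> - a)"
      "\<And>x. s \<le> x \<Longrightarrow> x < \<tau> \<Longrightarrow> norm (u x - a) < \<eta>"
    using \<open>s \<le> t\<close> by (elim first_time_ge) auto
  \<comment> \<open>The displacement bound needs the ball only strictly before the final time, so it
    applies at the exit time itself.\<close>
  have "norm (u \<tau> - u s) \<le> \<phi> (E (u s) - E a) / \<alpha>"
    using assms \<tau> by (intro desingularized_displacement_bound[OF \<phi>]) (auto simp: dist_norm norm_minus_commute)
  then show False
    using \<tau>(3) small norm_triangle_ineq[of "u \<tau> - u s" "u s - a"] by simp
qed

text \<open>Since \<open>\<phi>\<close> is continuous with \<open>\<phi> 0 = 0\<close>, some sampled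
  time makes both the distance to \<open>a\<close> and the desingularized energy small; from then on
  the displacement bound controls \<open>u\<close>.\<close>

lemma limit_point_imp_tendsto:
  assumes \<phi>: "desingularizing E a r \<eta> \<phi>"
    and T: "filterlim T at_top sequentially" and lim: "(\<lambda>n. u (T n)) \<longlonglongrightarrow> a"
  shows "(u \<longlongrightarrow> a) at_top"
proof (rule tendstoI)
  fix e :: real assume "e > 0"
  note above = energy_ge_limit_point[OF T lim]
  have "\<eta> > 0"
    using \<phi> by (simp add: desingularizing_def)
  have T0: "\<forall>\<^sub>F n in sequentially. 0 \<le> T n"
    using T by (simp add: filterlim_at_top)
  have in_ball: "\<forall>\<^sub>F n in sequentially. u (T n) \<in> ball a \<eta>"
    using tendstoD[OF lim \<open>\<eta> > 0\<close>] by (simp add: dist_commute)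
  have "(\<lambda>n. \<phi> (E (u (T n)) - E a)) \<longlonglongrightarrow> \<phi> 0"
  proof (rule continuous_on_tendsto_compose[of "{0..<r}" \<phi>])
    show "continuous_on {0..<r} \<phi>" "0 \<in> {0..<r}"
      using \<phi> by (simp_all add: desingularizing_def)
    show "(\<lambda>n. E (u (T n)) - E a) \<longlonglongrightarrow> 0"
      using continuous_energy lim by (subst LIM_zero_iff) (auto intro: continuous_on_tendsto_compose)
    show "\<forall>\<^sub>F n in sequentially. E (u (T n)) - E a \<in> {0..<r}"
      using T0 in_ball
    proof eventually_elim
      case (elim n)
      then show ?case
        using above[of "T n"] desingularizing_range[OF \<phi>, of "u (T n)"] by simp
    qed
  qed
  then have "(\<lambda>n. norm (u (T n) - a) + \<phi> (E (u (T n)) - E a) / \<alpha>) \<longlonglongrightarrow> norm (a - a) + \<phi> 0 / \<alpha>"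
    using alpha_pos by (intro tendsto_intros lim) auto
  \<comment> \<open>The bound by \<open>\<eta>\<close> gives trapping, the bound by \<open>e\<close>
    the required closeness.\<close>
  moreover have "norm (a - a) + \<phi> 0 / \<alpha> < min e \<eta>"
    using \<phi> \<open>e > 0\<close> by (simp add: desingularizing_def)
  ultimately have "\<forall>\<^sub>F n in sequentially. norm (u (T n) - a) + \<phi> (E (u (T n)) - E a) / \<alpha> < min e \<eta>"
    by (rule order_tendstoD)
  from eventually_happens[OF eventually_conj[OF this eventually_conj[OF T0 in_ball]]]
  obtain s where s: "norm (u s - a) + \<phi> (E (u s) - E a) / \<alpha> < e"
      "norm (u s - a) + \<phi> (E (u s) - E a) / \<alpha> < \<eta>" "0 \<le> s" "u s \<in> ball a \<eta>"
    by auto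
  have "dist (u t) a < e" if "s \<le> t" for t
  proof -
    have "norm (u t - u s) \<le> \<phi> (E (u s) - E a) / \<alpha>"
    proof (rule desingularized_displacement_bound[OF \<phi> s(3) that s(4)])
      show "u x \<in> ball a \<eta>" if "s \<le> x" for x
        by (rule trapping[OF \<phi> above s(3,2,4) that])
      show "E a \<le> E (u t)"
        using s(3) that by (intro above) simp
    qed
    then show ?thesis
      using s(1) norm_triangle_ineq[of "u t - u s" "u s - a"] by (simp add: dist_norm)
  qed
  then show "\<forall>\<^sub>F t in at_top. dist (u t) a < e"
    by (auto simp: eventually_at_top_linorder)
qed

section \<open>The distance estimate for a convergent trajectory\<close>

lemma energy_ge_limit:
  assumes "(u \<longlongrightarrow> a) at_top" "0 \<le> t"
  shows "E a \<le> E (u t)"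
  by (rule energy_ge_limit_point[OF filterlim_real_sequentially
        filterlim_compose[OF assms(1) filterlim_real_sequentially] assms(2)])

lemma eventually_in_ball:
  assumes "(u \<longlongrightarrow> a) at_top" "0 < \<eta>"
  obtains s where "t \<le> s" "\<And>x. s \<le> x \<Longrightarrow> u x \<in> ball a \<eta>"
proof -
  have "\<forall>\<^sub>F x in at_top. u x \<in> ball a \<eta>"
    using tendstoD[OF assms] by (simp add: dist_commute)
  then obtain s where "\<And>x. s \<le> x \<Longrightarrow> u x \<in> ball a \<eta>"
    by (auto simp: eventually_at_top_linorder)
  then show thesis
    using that[of "max s t"] by simp
qed

text \<open>The trajectory may leave the ball after time \<open>t\<close>. If it does, the bound at the times following the
  last exit shows that \<open>\<eta>\<close> itself is at most the right-hand side.\<close>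

lemma desingularized_distance_bound:
  assumes \<phi>: "desingularizing E a r \<eta> \<phi>" and lim: "(u \<longlongrightarrow> a) at_top"
    and "0 \<le> t" and ut: "u t \<in> ball a \<eta>"
  shows "norm (u t - a) \<le> \<phi> (E (u t) - E a) / \<alpha>"
proof -
  note above = energy_ge_limit[OF lim]
  have "\<eta> > 0"
    using \<phi> by (simp add: desingularizing_def)
  \<comment> \<open>The displacement bound from \<open>s\<close> passes to the limit at infinity;
    energy decrease and monotonicity of \<open>\<phi>\<close> then replace \<open>s\<close> by
    \<open>t\<close> on the right.\<close>
  have *: "norm (u s - a) \<le> \<phi> (E (u t) - E a) / \<alpha>"
    if "t \<le> s" and ball: "\<And>x. s \<le> x \<Longrightarrow> u x \<in> ball a \<eta>" for s
  proof -
    have "((\<lambda>x. norm (u x - u s)) \<longlongrightarrow> norm (a - u s)) at_top"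
      by (intro tendsto_intros lim)
    moreover have "\<forall>\<^sub>F x in at_top. norm (u x - u s) \<le> \<phi> (E (u s) - E a) / \<alpha>"
      using \<open>0 \<le> t\<close> that
      by (intro eventually_mono[OF eventually_ge_at_top[of s]] desingularized_displacement_bound[OF \<phi>] above) auto
    ultimately have "norm (a - u s) \<le> \<phi> (E (u s) - E a) / \<alpha>"
      by (rule tendsto_upperbound) simp
    also have "\<dots> \<le> \<phi> (E (u t) - E a) / \<alpha>"
    proof -
      have "E (u t) - E a < r"
        using desingularizing_range[OF \<phi> ut] by simp
      then show ?thesis
        using above[of s] energy_antimono[of t s] \<open>0 \<le> t\<close> \<open>t \<le> s\<close> alpha_pos
        by (intro divide_right_mono desingularizing_mono[OF \<phi>]) auto
    qed
    finally show ?thesis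
      by (simp add: norm_minus_commute)
  qed
  show ?thesis
  proof (cases "\<forall>x\<ge>t. u x \<in> ball a \<eta>")
    case True
    then show ?thesis
      using *[of t] by simp
  next
    case False
    then obtain s where s: "t \<le> s" "\<eta> \<le> norm (u s - a)"
      by (auto simp: dist_norm norm_minus_commute not_less)
    obtain S where S: "s \<le> S" "\<And>x. S \<le> x \<Longrightarrow> u x \<in> ball a \<eta>"
      using eventually_in_ball[OF lim \<open>\<eta> > 0\<close>] by blast
    have "continuous_on {s..S} (\<lambda>x. norm (u x - a))"
      using s \<open>0 \<le> t\<close> by (intro continuous_intros continuous_on_subset[OF continuous_solution]) auto
    then obtain \<tau> where \<tau>: "s \<le> \<tau>" "\<eta> \<le> norm (u \<tau> - a)"
        "\<And>x. \<tau> < x \<Longrightarrow> x \<le> S \<Longrightarrow> norm (u x - a) < \<eta>"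
      using s S by (elim last_time_ge) auto
    have "u x \<in> ball a \<eta>" if "\<tau> < x" for x
      using S(2)[of x] \<tau>(3)[OF that] by (cases "x \<le> S") (auto simp: dist_norm norm_minus_commute)
    then have le: "norm (u x - a) \<le> \<phi> (E (u t) - E a) / \<alpha>" if "\<tau> < x" for x
      using *[of x] that s \<tau> by simp
    \<comment> \<open>The bound holds just after \<open>\<tau>\<close>; right continuity carries it
      to \<open>\<tau>\<close>, where the distance is at least \<open>\<eta>\<close> and so exceeds
      that of \<open>u t\<close>.\<close>
    have "(u \<longlongrightarrow> u \<tau>) (at \<tau> within {0..})"
      using continuous_solution s \<tau> \<open>0 \<le> t\<close> by (simp add: continuous_on)
    then have "(u \<longlongrightarrow> u \<tau>) (at_right \<tau>)"
      by (rule tendsto_within_subset) (use s \<tau> \<open>0 \<le> t\<close> in auto)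
    then have "((\<lambda>x. norm (u x - a)) \<longlongrightarrow> norm (u \<tau> - a)) (at_right \<tau>)"
      by (intro tendsto_intros)
    then have "norm (u \<tau> - a) \<le> \<phi> (E (u t) - E a) / \<alpha>"
      by (rule tendsto_upperbound) (use le in \<open>auto simp: eventually_at_filter\<close>)
    then show ?thesis
      using \<tau> ut by (simp add: dist_norm norm_minus_commute)
  qed
qed

section \<open>Velocity of a convergent trajectory\<close>

text \<open>The length estimate bounds the arc length of the tail that remains in the ball,
  uniformly in the final time; continuity handles the compact initial piece.\<close>

lemma field_absolutely_integrable:
  assumes \<phi>: "desingularizing E a r \<eta> \<phi>" and lim: "(u \<longlongrightarrow> a) at_top"
  shows "(\<lambda>t. F (u t)) absolutely_integrable_on {0..}"
proof -
  have "\<eta> > 0"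
    using \<phi> by (simp add: desingularizing_def)
  then obtain s where s: "0 \<le> s" "\<And>x. s \<le> x \<Longrightarrow> u x \<in> ball a \<eta>"
    using eventually_in_ball[OF lim] by blast
  have cont: "continuous_on A (\<lambda>t. F (u t))" if "A \<subseteq> {0..}" for A
    using continuous_field_solution that by (rule continuous_on_subset)
  have "(\<lambda>t. F (u t)) absolutely_integrable_on {s..}"
  proof (rule absolutely_integrable_on_atLeastI[OF cont])
    fix t assume "s \<le> t"
    \<comment> \<open>Arc length takes the role of \<open>g\<close>: its derivative is exactly the
      speed.\<close>
    let ?G = "\<lambda>y. integral {s..y} (\<lambda>x. norm (F (u x)))"
    have contn: "continuous_on {s..t} (\<lambda>x. norm (F (u x)))"
      using s by (intro continuous_intros cont) auto
    have G: "(?G has_vector_derivative norm (F (u x))) (at x within {s..t})" if "x \<in> {s..t}" for x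
      by (rule integral_has_vector_derivative[OF contn that])
    have "norm (?G t - ?G s) \<le> \<phi> (E (u s) - E a) / \<alpha>"
    proof (rule desingularized_length_bound[OF \<phi> s(1) \<open>s \<le> t\<close>])
      show "continuous_on {s..t} ?G"
        using G by (meson continuous_on_eq_continuous_within has_vector_derivative_continuous)
      show "(?G has_vector_derivative norm (F (u x))) (at x)" if "s < x" "x < t" for x
        using G[of x] that by (simp add: at_within_Icc_at)
    qed (use s \<open>s \<le> t\<close> energy_ge_limit[OF lim] in auto)
    then show "?G t \<le> \<phi> (E (u s) - E a) / \<alpha>"
      by simp
  qed (use s in auto)
  moreover have "(\<lambda>t. F (u t)) absolutely_integrable_on {0..s}"
    by (intro absolutely_integrable_continuous_real cont) auto
  ultimately have "(\<lambda>t. F (u t)) absolutely_integrable_on ({0..s} \<union> {s..})"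
    by (intro set_integrable_Un) auto
  moreover have "{0..s} \<union> {s..} = {0..}"
    using s by auto
  ultimately show ?thesis
    by simp
qed

text \<open>By continuity the velocity tends to \<open>- F a\<close>, and a convergent trajectory
  admits only zero as velocity limit.\<close>

lemma limit_is_rest_point:
  assumes "(u \<longlongrightarrow> a) at_top"
  shows "F a = 0"
proof -
  have "((\<lambda>t. F (u t)) \<longlongrightarrow> F a) at_top"
    by (rule continuous_on_tendsto_compose[OF continuous_field assms]) auto
  then have "((\<lambda>t. - F (u t)) \<longlongrightarrow> - F a) at_top"
    by (rule tendsto_minus)
  then show ?thesis
    using convergent_imp_limit_velocity_eq_0[OF solution_at assms] neg_equal_0_iff_equal by blast
qed

text \<open>Without divergence of the norm, some fixed ball is visited at arbitrarily late times;
  compactness yields a convergent subsequence.\<close>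

lemma bounded_limit_point:
  assumes "\<not> filterlim (\<lambda>t. norm (u t)) at_top at_top"
  obtains T a where "filterlim T at_top sequentially" "(\<lambda>n. u (T n)) \<longlonglongrightarrow> a"
proof -
  obtain B where "\<not> (\<forall>\<^sub>F t in at_top. B \<le> norm (u t))"
    using assms unfolding filterlim_at_top by blast
  then have "\<exists>t\<ge>real n. norm (u t) \<le> B" for n
    unfolding eventually_at_top_linorder by (meson linear)
  then obtain T where T: "\<And>n. real n \<le> T n" "\<And>n. norm (u (T n)) \<le> B"
    by metis
  then have "bounded (range (\<lambda>n. u (T n)))"
    by (auto simp: bounded_iff)
  then obtain a f where f: "strict_mono f" "((\<lambda>n. u (T n)) \<circ> f) \<longlonglongrightarrow> a"
    using bounded_imp_convergent_subsequence by blast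
  have "filterlim T at_top sequentially"
    using T(1) by (intro filterlim_at_top_mono[OF filterlim_real_sequentially]) auto
  then have "filterlim (\<lambda>n. T (f n)) at_top sequentially"
    by (rule filterlim_compose) (rule filterlim_subseq[OF f(1)])
  then show thesis
    using f(2) that[of "\<lambda>n. T (f n)"] by (simp add: o_def)
qed

text \<open>The half-line is open because the two-sided derivative is identified with
  \<open>- F (u t)\<close> at positive times only.\<close>

lemma velocity_absolutely_integrable:
  assumes "desingularizing E a r \<eta> \<phi>" "(u \<longlongrightarrow> a) at_top"
  shows "(\<lambda>t. vector_derivative u (at t)) absolutely_integrable_on {0<..}"
proof -
  have "(\<lambda>t. F (u t)) absolutely_integrable_on {0<..}"
    using field_absolutely_integrable[OF assms] by (rule set_integrable_subset) auto
  then have "(\<lambda>t. - F (u t)) absolutely_integrable_on {0<..}"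
    by (simp add: set_integrable_def)
  moreover have "(\<lambda>t. vector_derivative u (at t)) absolutely_integrable_on {0<..} \<longleftrightarrow>
      (\<lambda>t. - F (u t)) absolutely_integrable_on {0<..}"
    by (rule set_integrable_cong) (auto intro!: vector_derivative_at solution_at)
  ultimately show ?thesis
    by simp
qed

lemma velocity_tendsto_0:
  assumes "(u \<longlongrightarrow> a) at_top"
  shows "((\<lambda>t. vector_derivative u (at t)) \<longlongrightarrow> 0) at_top"
proof -
  have "((\<lambda>t. F (u t)) \<longlongrightarrow> F a) at_top"
    by (rule continuous_on_tendsto_compose[OF continuous_field assms]) auto
  then have "((\<lambda>t. - F (u t)) \<longlongrightarrow> - F a) at_top"
    by (rule tendsto_minus)
  moreover have "\<forall>\<^sub>F t in at_top. - F (u t) = vector_derivative u (at t)"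
    using eventually_gt_at_top[of 0]
    by eventually_elim (simp add: vector_derivative_at[OF solution_at])
  ultimately show ?thesis
    using limit_is_rest_point[OF assms] by (simp add: Lim_transform_eventually)
qed

end

theorem theorem3p2:
  fixes F :: "real ^ 'n \<Rightarrow> real ^ 'n"
    and E :: "real ^ 'n \<Rightarrow> real"
    and u :: "real \<Rightarrow> real ^ 'n"
  assumes "locally_lipschitz F"
    and "\<forall>x. E differentiable (at x)"
    and "quasi_gradient_on UNIV F E"
    and "KL_function E"
    and "\<forall>t\<ge>0. (u has_vector_derivative - F (u t)) (at t within {0..})"
  shows "(filterlim (\<lambda>t. norm (u t)) at_top at_top \<or>
            (\<exists>u_inf. (u \<longlongrightarrow> u_inf) at_top \<and> F u_inf = 0)) \<and>
         (\<forall>u_inf. (u \<longlongrightarrow> u_inf) at_top \<and> F u_inf = 0 \<longrightarrow>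
            (\<lambda>t. vector_derivative u (at t)) absolutely_integrable_on {0<..} \<and>
            ((\<lambda>t. vector_derivative u (at t)) \<longlongrightarrow> 0) at_top \<and>
            (\<forall>\<alpha> r \<eta> \<phi>. angle_constant UNIV F E \<alpha> \<and> desingularizing E u_inf r \<eta> \<phi> \<longrightarrow>
               (\<forall>t\<ge>0. u t \<in> ball u_inf \<eta> \<longrightarrow>
                  0 \<le> E (u t) - E u_inf \<and>
                  norm (u t - u_inf) \<le> (1 / \<alpha>) * \<phi> (E (u t) - E u_inf))))"
proof -
  have flow: "angle_descent_flow F E u \<alpha>" if "angle_constant UNIV F E \<alpha>" for \<alpha>
  proof
    show "F x = 0" if "grad E x = 0" for x
      using assms(3) that by (auto simp: quasi_gradient_on_def crit_def)
  qed (use assms that in \<open>auto intro: locally_lipschitz_imp_continuous_on\<close>)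
  obtain \<alpha> where "angle_constant UNIV F E \<alpha>"
    using assms(3) by (auto simp: quasi_gradient_on_def)
  then interpret angle_descent_flow F E u \<alpha>
    by (rule flow)
  have KL: "\<exists>r \<eta> \<phi>. desingularizing E a r \<eta> \<phi>" for a
    using assms(4) by (simp add: KL_function_def KL_at_def)
  show ?thesis
  proof (intro conjI allI impI)
    show "filterlim (\<lambda>t. norm (u t)) at_top at_top \<or> (\<exists>u_inf. (u \<longlongrightarrow> u_inf) at_top \<and> F u_inf = 0)"
      by (metis KL bounded_limit_point limit_point_imp_tendsto limit_is_rest_point)
  next
    fix u_inf assume "(u \<longlongrightarrow> u_inf) at_top \<and> F u_inf = 0"
    then have lim: "(u \<longlongrightarrow> u_inf) at_top"
      by simp
    show "(\<lambda>t. vector_derivative u (at t)) absolutely_integrable_on {0<..}"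
      using KL velocity_absolutely_integrable[OF _ lim] by blast
    show "((\<lambda>t. vector_derivative u (at t)) \<longlongrightarrow> 0) at_top"
      by (rule velocity_tendsto_0[OF lim])
    \<comment> \<open>This \<open>\<alpha>\<close> shadows the interpreted constant; the bound comes
      from the locale instantiated at the new one.\<close>
    fix \<alpha> r \<eta> \<phi> t
    assume "angle_constant UNIV F E \<alpha> \<and> desingularizing E u_inf r \<eta> \<phi>" "0 \<le> t" "u t \<in> ball u_inf \<eta>"
    then show "norm (u t - u_inf) \<le> (1 / \<alpha>) * \<phi> (E (u t) - E u_inf)"
      using angle_descent_flow.desingularized_distance_bound[OF flow _ lim, of \<alpha> r \<eta> \<phi> t] by simp
    show "0 \<le> E (u t) - E u_inf"
      using energy_ge_limit[OF lim \<open>0 \<le> t\<close>] by simp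
  qed
qed

end
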